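(* Let $a$ and $b$ be complex numbers and let $n$ be a nonnegative integer, such that all terms below are well defined (no Gamma function in a numerator, for $0\le k\le n$, is evaluated at a pole, and $(a+b)_n(1+a-b)_n\neq 0$). Then $$\sum_{k=0}^{n}\frac{\Gamma(1+k)\,\Gamma(\tfrac32+k)\,\Gamma(1-a-b+k)\,\Gamma(b-a+k)\,\Gamma(a+n+k)\,\Gamma(\tfrac{1-a-b}{2}-\tfrac k2)\,\Gamma(\tfrac{b-a}{2}-\tfrac k2)}{\Gamma(1+n-k)\,\Gamma(2+n+k)\,\Gamma(2-a-n+k)\,\Gamma(\tfrac12+k)\,\Gamma(\tfrac{1-a-b}{2}+\tfrac k2)\,\Gamma(\tfrac{b-a}{2}+\tfrac k2)}\,\frac{1}{4^k\,k!}$$ $$=\frac{(b)_n\,(1-b)_n}{(a+b)_n\,(1+a-b)_n}\;\frac{\Gamma(a+n)\,\Gamma(1-a-b)\,\Gamma(b-a)}{2\,\Gamma(1+n)\,\Gamma(2-a)}.$$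
   Context: $(x)_0=1$ and $(x)_n=x(x+1)\cdots(x+n-1)$ for $n\ge 1$ is the shifted factorial. $\Gamma$ is the gamma function (meromorphically continued), with $1/\Gamma$ entire, so $1/\Gamma$ is $0$ at the poles of $\Gamma$. The left-hand side is the value at $z=\frac14$ of a terminating Fox-Wright function ${}_7\Psi_6$, where in general ${}_p\Psi_q[z]=\sum_{k\ge0}\frac{\prod_{i=1}^p\Gamma(\alpha_i+A_ik)}{\prod_{j=1}^q\Gamma(\beta_j+B_jk)}\frac{z^k}{k!}$; the factor $1/\Gamma(1+n-k)$ makes the series terminate at $k=n$. *)

theory Defs
  imports "HOL-Analysis.Analysis"
begin

end

theory Submission
  imports Defs
begin

text \<open>
  Put \<open>X = 1 - a - b\<close> and \<open>Y = b - a\<close>, and let \<open>h X k = \<Gamma>(X + k) \<Gamma>((X - k)/2) / \<Gamma>((X + k)/2)\<close>.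
  The functional equation of \<open>\<Gamma>\<close> gives a recurrence in \<open>k\<close> with step 2 for \<open>h X k * h Y k / 4 ^ k\<close>; it is
  the recurrence of Whipple's terminating series \<open>3F2(-k, k + 1, a; a + b, 1 + a - b; 1)\<close>, so the two
  agree up to the factor \<open>\<Gamma>(X) \<Gamma>(Y)\<close>. After inserting this series and interchanging the sums,
  the inner sum over \<open>k\<close> is a very-well-poised \<open>4F3(-1)\<close> and the remaining outer sum is a
  Saalschuetz \<open>3F2(-n, a, a + n; a + b, 1 + a - b; 1)\<close>. The three hypergeometric facts
  are proved by creative telescoping: in each proof \<open>G\<close> is the certificate in the sense of Zeilberger.
\<close>

section \<open>Ratios of binomial coefficients and shifted factorials\<close>

text \<open>The difference is taken in the field, so the ratio also holds for \<open>i > n\<close>,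
  where both sides vanish. Certificates can thus be checked at the end of a summation range without
  truncated subtraction.\<close>

lemma of_nat_choose_Suc:
  "(of_nat (n choose Suc i) :: 'a :: field_char_0) = of_nat (n choose i) * (of_nat n - of_nat i) / (of_nat i + 1)"
proof (cases "i \<le> n")
  case True
  have "Suc i * (n choose Suc i) = (n choose i) * (n - i)"
    by (metis binomial_absorb_comp binomial_absorption mult.commute)
  then have "of_nat (Suc i * (n choose Suc i)) = (of_nat ((n choose i) * (n - i)) :: 'a)"
    by simp
  with True show ?thesis
    using of_nat_neq_0[of i, where 'a = 'a] by (simp add: of_nat_diff field_simps)
qed (simp add: binomial_eq_0)

lemma of_nat_Suc_choose_Suc:
  "(of_nat (Suc n choose Suc i) :: 'a :: field_char_0) = of_nat (n choose i) * (of_nat n + 1) / (of_nat i + 1)"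
proof -
  have "(of_nat i + 1 :: 'a) \<noteq> 0"
    by (metis of_nat_Suc add.commute of_nat_neq_0)
  then show ?thesis
    by (simp add: of_nat_choose_Suc divide_simps) (simp add: algebra_simps)
qed

lemma pochhammer_neq_0_iff:
  "pochhammer (x :: 'a :: field_char_0) n \<noteq> 0 \<longleftrightarrow> (\<forall>j<n. x + of_nat j \<noteq> 0)"
  by (auto simp: pochhammer_eq_0_iff eq_neg_iff_add_eq_0)

lemma pochhammer_of_nat_plus_1:
  "pochhammer (of_nat m + 1 :: 'a :: field_char_0) r = fact (m + r) / fact m"
proof -
  have "(fact (m + r) :: 'a) = fact m * pochhammer (of_nat m + 1) r"
    by (simp add: pochhammer_fact pochhammer_product' add.commute)
  then show ?thesis by simp
qed

section \<open>Saalschuetz's balanced terminating 3F2\<close>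

text \<open>The sum S(n) satisfies the first-order recurrence (p + n)(q + n) S(n + 1) = (p - a +
  n)(q - a + n) S(n), and so does the product. The condition on \<open>p + q\<close> says that the
  3F2 is balanced; it also puts the right-hand side into a form symmetric in \<open>p\<close> and
  \<open>q\<close>.\<close>

lemma saalschuetz_summation:
  fixes a u p q :: "'a :: field_char_0"
  assumes "p + q = 1 + a + u" "\<And>j. j < n \<Longrightarrow> p + of_nat j \<noteq> 0" "\<And>j. j < n \<Longrightarrow> q + of_nat j \<noteq> 0"
  shows "(\<Sum>j\<le>n. (-1) ^ j * of_nat (n choose j) * pochhammer a j * pochhammer (u + of_nat n) j
            / (pochhammer p j * pochhammer q j))
         = pochhammer (p - a) n * pochhammer (q - a) n / (pochhammer p n * pochhammer q n)"
  using assms(2,3)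
proof (induction n)
  case 0
  then show ?case by simp
next
  case (Suc n)
  define F where "F n j = (-1) ^ j * of_nat (n choose j) * pochhammer a j * pochhammer (u + of_nat n) j
            / (pochhammer p j * pochhammer q j)" for n j
  \<comment> \<open>\<open>G\<close> vanishes at 0 by definition and at \<open>Suc (Suc n)\<close>
    through \<open>n choose Suc n = 0\<close>, so its differences sum to 0. The factor
    \<open>1 + u + 2 * of_nat n\<close> is forced by \<open>tele\<close> at \<open>j = 0\<close>,
    where \<open>p + q - a = 1 + u\<close>.\<close>
  define G where "G j = (case j of 0 \<Rightarrow> 0 | Suc i \<Rightarrow> (1 + u + 2 * of_nat n) * (-1) ^ i * of_nat (n choose i) * pochhammer a (Suc i)
      * pochhammer (u + of_nat n + 1) i / (pochhammer p i * pochhammer q i))" for j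
  have nz: "pochhammer p j \<noteq> 0" "pochhammer q j \<noteq> 0" if "j \<le> Suc n" for j
    using that Suc.prems by (auto simp: pochhammer_neq_0_iff)
  have tele: "(p + of_nat n) * (q + of_nat n) * F (Suc n) j - (p - a + of_nat n) * (q - a + of_nat n) * F n j
      = G (Suc j) - G j" if "j \<le> Suc n" for j
  proof (cases j)
    case 0
    have "(p + of_nat n) * (q + of_nat n) - (p - a + of_nat n) * (q - a + of_nat n)
            = a * (p + q + 2 * of_nat n - a)"
      by (simp add: algebra_simps)
    then show ?thesis using assms(1) 0 by (simp add: F_def G_def algebra_simps)
  next
    case (Suc i)
    \<comment> \<open>Every factor is reduced to its value at index \<open>i\<close>; after clearing
      denominators only a polynomial identity modulo the balancing condition is left.\<close>
    define x :: 'a where "x = of_nat n"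
    define y :: 'a where "y = of_nat i"
    define P where "P = pochhammer p i"
    define Q where "Q = pochhammer q i"
    define A where "A = pochhammer a i"
    define U where "U = pochhammer (u + x + 1) i"
    define C :: 'a where "C = of_nat (n choose i)"
    define S :: 'a where "S = (-1) ^ i"
    have y1: "y + 1 \<noteq> 0" unfolding y_def by (metis of_nat_Suc add.commute of_nat_neq_0)
    have c1: "of_nat (n choose Suc i) = C * (x - y) / (y + 1)"
      by (simp add: of_nat_choose_Suc C_def x_def y_def)
    have c2: "of_nat (Suc n choose Suc i) = C * (x + 1) / (y + 1)"
      by (simp only: of_nat_Suc_choose_Suc C_def x_def y_def)
    have u1: "pochhammer (u + of_nat n) (Suc i) = (u + x) * U"
      by (simp add: pochhammer_rec U_def x_def)
    have u2: "pochhammer (u + of_nat (Suc n)) (Suc i) = U * (u + x + 1 + y)"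
      by (simp add: pochhammer_Suc U_def x_def y_def algebra_simps)
    have u3: "pochhammer (u + of_nat n + 1) (Suc i) = U * (u + x + 1 + y)"
      by (simp add: pochhammer_Suc U_def x_def y_def algebra_simps)
    have a: "pochhammer a (Suc i) = A * (a + y)" "pochhammer p (Suc i) = P * (p + y)" "pochhammer q (Suc i) = Q * (q + y)"
      "pochhammer a (Suc (Suc i)) = A * (a + y) * (a + y + 1)"
      by (simp_all add: pochhammer_Suc A_def P_def Q_def y_def add_ac)
    have nz': "P \<noteq> 0" "Q \<noteq> 0" "p + y \<noteq> 0" "q + y \<noteq> 0"
      using nz[of "Suc i"] that Suc unfolding a by auto
    show ?thesis
      unfolding F_def G_def Suc u1 u2 u3 nat.case c1 c2 a power_Suc
      unfolding x_def[symmetric] y_def[symmetric] C_def[symmetric] P_def[symmetric] Q_def[symmetric]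
        U_def[symmetric] S_def[symmetric]
      using nz' y1 assms(1) by (simp add: divide_simps) algebra
  qed
  have "(\<Sum>j\<le>Suc n. (p + of_nat n) * (q + of_nat n) * F (Suc n) j - (p - a + of_nat n) * (q - a + of_nat n) * F n j)
      = (\<Sum>j\<le>Suc n. G (Suc j) - G j)"
    by (intro sum.cong refl tele) auto
  also have "\<dots> = 0"
    unfolding lessThan_Suc_atMost[symmetric] by (subst sum_lessThan_telescope) (simp add: G_def binomial_eq_0)
  finally have "(p + of_nat n) * (q + of_nat n) * (\<Sum>j\<le>Suc n. F (Suc n) j)
     = (p - a + of_nat n) * (q - a + of_nat n) * (\<Sum>j\<le>Suc n. F n j)"
    by (simp only: sum_subtractf sum_distrib_left[symmetric]) simp
  also have "(\<Sum>j\<le>Suc n. F n j) = (\<Sum>j\<le>n. F n j)"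
    by (simp add: F_def)
  also have "\<dots> = pochhammer (p - a) n * pochhammer (q - a) n / (pochhammer p n * pochhammer q n)"
    unfolding F_def by (rule Suc.IH) (use Suc.prems in auto)
  finally have eq: "(p + of_nat n) * (q + of_nat n) * (\<Sum>j\<le>Suc n. F (Suc n) j) = (p - a + of_nat n) * (q - a + of_nat n)
      * (pochhammer (p - a) n * pochhammer (q - a) n / (pochhammer p n * pochhammer q n))" .
  have "(\<Sum>j\<le>Suc n. F (Suc n) j)
      = (p + of_nat n) * (q + of_nat n) * (\<Sum>j\<le>Suc n. F (Suc n) j) / ((p + of_nat n) * (q + of_nat n))"
    using Suc.prems[of n] by (simp del: sum.atMost_Suc)
  also have "\<dots> = pochhammer (p - a) (Suc n) * pochhammer (q - a) (Suc n) / (pochhammer p (Suc n) * pochhammer q (Suc n))"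
    unfolding eq by (simp add: pochhammer_Suc mult_ac)
  finally have "(\<Sum>j\<le>Suc n. F (Suc n) j) = pochhammer (p - a) (Suc n) * pochhammer (q - a) (Suc n) / (pochhammer p (Suc n) * pochhammer q (Suc n))" .
  then show ?case unfolding F_def .
qed

section \<open>The very-well-poised 4F3 at -1\<close>

text \<open>This is 4F3(m, 1 + m/2, c, -n; m/2, m + 1 - c, m + n + 1; -1), divided by its known
  value so that the sum is 1 and the recurrence in \<open>n\<close> merely says that it is constant.
  Keeping the factors with \<open>c\<close> in the numerator makes the identity valid for every
  \<open>c\<close>.\<close>

lemma very_well_poised_4F3_summation:
  fixes c m :: "'a :: field_char_0"
  assumes "\<And>i. m + of_nat i \<noteq> 0"
  shows "(\<Sum>i\<le>n. of_nat (n choose i) * (m + 2 * of_nat i) * pochhammer c i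
            * pochhammer (m + of_nat i + 1 - c) (n - i) / pochhammer (m + of_nat i) (Suc n)) = 1"
proof (induction n)
  case 0
  show ?case using assms[of 0] by simp
next
  case (Suc n)
  define T where "T n i = of_nat (n choose i) * (m + 2 * of_nat i) * pochhammer c i
            * pochhammer (m + of_nat i + 1 - c) (n - i) / pochhammer (m + of_nat i) (Suc n)" for n i
  define G where "G i = (case i of 0 \<Rightarrow> 0 | Suc h \<Rightarrow> - of_nat (n choose h) * pochhammer c (Suc h)
      * pochhammer (m + of_nat h + 1 - c) (n - h) / pochhammer (m + of_nat h + 1) (Suc n))" for i
  have tele: "T (Suc n) i - T n i = G (Suc i) - G i" if "i \<le> Suc n" for i
  proof -
    define y :: 'a where "y = of_nat i"
    define x :: 'a where "x = of_nat n"
    define M where "M = pochhammer (m + y + 1) n"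
    have nz0: "m + y \<noteq> 0" "m + y + 1 + x \<noteq> 0"
      using assms[of i] assms[of "i + 1 + n"] by (simp_all add: y_def x_def add_ac)
    have nzM: "M \<noteq> 0"
      using assms[of "i + 1 + k" for k] by (simp add: M_def y_def pochhammer_neq_0_iff add_ac)
    have m: "pochhammer (m + y) (Suc n) = (m + y) * M"
      "pochhammer (m + y) (Suc (Suc n)) = (m + y) * (M * (m + y + 1 + x))"
      "pochhammer (m + y + 1) (Suc n) = M * (m + y + 1 + x)"
      by (simp_all add: M_def pochhammer_rec[of "m + y"] pochhammer_Suc[of "m + y + 1"] x_def)
    \<comment> \<open>The lengths \<open>n - i\<close> and \<open>n - h\<close> are honest
      differences as long as \<open>i <= n\<close>. At \<open>i = Suc n\<close> the subtraction
      truncates, but there \<open>T n i\<close> is 0 by its binomial coefficient.\<close>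
    have "i = 0 \<or> (\<exists>h. i = Suc h \<and> h < n) \<or> i = Suc n"
      using that by (cases i) auto
    then consider "i = 0" | h where "i = Suc h" "h < n" | "i = Suc n"
      by blast
    then show ?thesis
    proof cases
      case 1
      define C where "C = pochhammer (m + 1 - c) n"
      have C: "pochhammer (m + 1 - c) (Suc n) = C * (m + 1 - c + x)"
        by (simp add: C_def pochhammer_Suc x_def)
      have m': "m \<noteq> 0" "m + 1 + x \<noteq> 0" "y = 0" using nz0 1 by (auto simp: y_def)
      show ?thesis using m' nzM
        unfolding T_def G_def 1 nat.case using m[unfolded m'(3)]
        by (simp add: C C_def[symmetric] divide_simps del: pochhammer_Suc) (auto simp: algebra_simps)
    next
      case (2 h)
      define z :: 'a where "z = of_nat h"
      define k where "k = n - Suc h"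
      have k: "n = Suc h + k" using 2 by (simp add: k_def)
      have y: "y = z + 1" by (simp add: y_def z_def 2)
      define B :: 'a where "B = of_nat (n choose h)"
      have y1: "z + 1 \<noteq> 0" unfolding z_def by (metis of_nat_Suc add.commute of_nat_neq_0)
      have c1: "of_nat (n choose i) = B * (x - z) / (z + 1)"
        by (simp add: of_nat_choose_Suc 2 B_def x_def z_def)
      have c2: "of_nat (Suc n choose i) = B * (x + 1) / (z + 1)"
        by (simp only: of_nat_Suc_choose_Suc 2 B_def x_def z_def)
      define C where "C = pochhammer (m + z + 2 - c) k"
      have xk: "of_nat k = x - z - 1" by (simp add: x_def z_def k)
      have ni: "Suc n - i = Suc k" "n - i = k" "n - h = Suc k"
        by (simp_all add: k 2)
      have yz: "m + y + 1 - c = m + z + 2 - c" "m + z + 1 - c + 1 = m + z + 2 - c"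
        by (simp_all add: y algebra_simps)
      have C: "pochhammer (m + y + 1 - c) (Suc n - i) = C * (m + 1 - c + x)"
        "pochhammer (m + y + 1 - c) (n - i) = C"
        "pochhammer (m + z + 1 - c) (n - h) = (m + z + 1 - c) * C"
        unfolding ni yz(1) pochhammer_rec[of "m + z + 1 - c"] yz(2) pochhammer_Suc[of "m + z + 2 - c"] xk
        by (simp_all add: C_def)
      define D where "D = pochhammer c h"
      have D: "pochhammer c i = D * (c + z)" "pochhammer c (Suc i) = D * (c + z) * (c + z + 1)"
        by (simp_all add: D_def z_def 2 pochhammer_Suc algebra_simps)
      have G1: "G i = - B * (D * (c + z)) * ((m + z + 1 - c) * C) / ((m + y) * M)"
        using m(1) D(1) C(3) by (simp add: G_def 2 B_def y z_def[symmetric] add_ac)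
      have G2: "G (Suc i) = - (B * (x - z) / (z + 1)) * (D * (c + z) * (c + z + 1)) * C / (M * (m + y + 1 + x))"
        unfolding G_def nat.case c1 y_def[symmetric] D C m ..
      show ?thesis using nz0 nzM y1
        unfolding G1 G2 T_def c1 c2 y_def[symmetric] D C m unfolding y
        by (simp add: divide_simps) algebra
    next
      case 3
      have y: "y = x + 1" by (simp add: y_def x_def 3)
      have "T (Suc n) i = (m + 2 * (x + 1)) * pochhammer c (Suc n) / ((m + y) * (M * (m + y + 1 + x)))"
        using m(2) by (simp add: T_def 3 y_def x_def algebra_simps)
      \<comment> \<open>Since \<open>y = x + 1\<close>, the factor \<open>m + 2 * (x + 1)\<close> is
        exactly the last factor \<open>m + y + 1 + x\<close> of the denominator.\<close>
      also have "\<dots> = pochhammer c (Suc n) / ((m + y) * M)"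
        using nz0 nzM by (simp add: divide_simps y)
      finally show ?thesis using m(1)
        by (simp add: T_def[of n] G_def 3 y_def binomial_eq_0 algebra_simps)
    qed
  qed
  have "(\<Sum>i\<le>Suc n. T (Suc n) i - T n i) = (\<Sum>i\<le>Suc n. G (Suc i) - G i)"
    by (intro sum.cong refl tele) auto
  also have "\<dots> = 0"
    unfolding lessThan_Suc_atMost[symmetric] by (subst sum_lessThan_telescope) (simp add: G_def binomial_eq_0)
  finally have "(\<Sum>i\<le>Suc n. T (Suc n) i) = (\<Sum>i\<le>Suc n. T n i)"
    by (simp only: sum_subtractf) simp
  also have "\<dots> = (\<Sum>i\<le>n. T n i)"
    by (simp add: T_def)
  also have "\<dots> = 1" using Suc.IH unfolding T_def .
  finally show ?case unfolding T_def .
qed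

section \<open>The recurrence of Whipple's 3F2 in its terminating parameter\<close>

text \<open>The step is 2 to match Gamma arguments that contain k/2. The range stops at a common
  \<open>n\<close> instead of at \<open>k\<close>, which changes nothing because
  \<open>pochhammer (- of_nat k) j\<close> vanishes for \<open>j > k\<close>, and allows a termwise
  comparison of \<open>W (k + 2)\<close> with \<open>W k\<close>.\<close>

lemma whipple_3F2_recurrence:
  fixes a p q :: "'a :: field_char_0" and k n :: nat
  defines "W \<equiv> \<lambda>k. \<Sum>j\<le>n. pochhammer (- of_nat k) j * pochhammer (of_nat k + 1) j * pochhammer a j
                        / (pochhammer p j * pochhammer q j * fact j)"
  assumes pq: "p + q = 1 + 2 * a" and "k + 2 \<le> n"
    and nzp: "\<And>j. j < n \<Longrightarrow> p + of_nat j \<noteq> 0" and nzq: "\<And>j. j < n \<Longrightarrow> q + of_nat j \<noteq> 0"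
  shows "(p + of_nat k + 1) * (q + of_nat k + 1) * W (k + 2) = (of_nat k + 2 - p) * (of_nat k + 2 - q) * W k"
proof -
  define z :: 'a where "z = of_nat k"
  have z: "z + 1 \<noteq> 0" "z + 2 \<noteq> 0"
    unfolding z_def by (metis of_nat_Suc add.commute of_nat_neq_0)
      (metis add_2_eq_Suc' of_nat_add of_nat_neq_0 of_nat_numeral)
  \<comment> \<open>\<open>u\<close> takes the parameter -(k + 2) from \<open>W (k + 2)\<close> and
    \<open>v\<close> takes k + 1 from \<open>W k\<close>. With this mixture both
    \<open>F k j\<close> and \<open>F (k + 2) j\<close> are \<open>u j * v j * w j\<close> times a
    polynomial in \<open>j\<close>, over the same denominator
    \<open>(z + 1) * (z + 2)\<close>.\<close>
  define u where "u j = pochhammer (- z - 2) j" for j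
  define v where "v j = pochhammer (z + 1) j" for j
  define w where "w j = pochhammer a j / (pochhammer p j * pochhammer q j * fact j)" for j
  define \<kappa> where "\<kappa> = - 2 * (2 * z + 3) / ((z + 1) * (z + 2))"
  \<comment> \<open>The last three factors cancel the newest denominator factors of
    \<open>w j\<close>. The factor \<open>of_nat j\<close> gives \<open>G 0 = 0\<close>, while
    \<open>u (Suc n) = 0\<close> (from \<open>k + 2 <= n\<close>) gives
    \<open>G (Suc n) = 0\<close>.\<close>
  define G where "G j = \<kappa> * u j * v j * w j * of_nat j * (p + of_nat j - 1) * (q + of_nat j - 1)" for j
  define F where "F k j = pochhammer (- of_nat k) j * pochhammer (of_nat k + 1) j * w j" for k j
  have W: "W k = (\<Sum>j\<le>n. F k j)" for k
    by (simp add: W_def F_def w_def)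
  have u0: "u (Suc n) = 0"
  proof -
    have "- z - 2 = - of_nat (k + 2)" by (simp add: z_def)
    then show ?thesis using assms(3) unfolding u_def by (simp only: pochhammer_of_nat_eq_0_iff)
  qed
  have tele: "(p + z + 1) * (q + z + 1) * F (k + 2) j - (z + 2 - p) * (z + 2 - q) * F k j = G (Suc j) - G j"
    if "j \<le> n" for j
  proof -
    define y :: 'a where "y = of_nat j"
    have "pochhammer (-z - 2) (Suc (Suc j)) = (-z-2) * (-z-1) * pochhammer (-z) j"
      by (simp add: pochhammer_rec)
    moreover have "pochhammer (-z - 2) (Suc (Suc j)) = u j * (y - z - 2) * (y - z - 1)"
      by (simp add: pochhammer_Suc u_def y_def algebra_simps)
    ultimately have "pochhammer (-z) j * ((z + 1) * (z + 2)) = u j * (y - z - 2) * (y - z - 1)"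
      by algebra
    then have u1: "pochhammer (-z) j = u j * (y - z - 2) * (y - z - 1) / ((z + 1) * (z + 2))"
      using z by (simp add: eq_divide_eq)
    have "pochhammer (z + 1) (Suc (Suc j)) = (z+1) * (z+2) * pochhammer (z + 3) j"
      by (simp add: pochhammer_rec algebra_simps)
    moreover have "pochhammer (z + 1) (Suc (Suc j)) = v j * (z + 1 + y) * (z + 2 + y)"
      by (simp add: pochhammer_Suc v_def y_def algebra_simps)
    ultimately have "pochhammer (z + 3) j * ((z + 1) * (z + 2)) = v j * (z + 1 + y) * (z + 2 + y)"
      by algebra
    then have v1: "pochhammer (z + 3) j = v j * (z + 1 + y) * (z + 2 + y) / ((z + 1) * (z + 2))"
      using z by (simp add: eq_divide_eq)
    have F1: "F k j = u j * (y - z - 2) * (y - z - 1) / ((z + 1) * (z + 2)) * v j * w j"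
      unfolding F_def z_def[symmetric] u1 v_def ..
    have F2: "F (k + 2) j = u j * (v j * (z + 1 + y) * (z + 2 + y) / ((z + 1) * (z + 2))) * w j"
    proof -
      have "- of_nat (k + 2) = - z - 2" "of_nat (k + 2) + 1 = z + 3"
        by (simp_all add: z_def)
      then show ?thesis unfolding F_def by (simp only: v1 u_def)
    qed
    have G1: "G (Suc j) = \<kappa> * u j * (y - z - 2) * v j * (z + 1 + y) * w j * (a + y)"
    proof (cases "j = n")
      \<comment> \<open>\<open>p + n\<close> and \<open>q + n\<close> may vanish, but the numerator factor \<open>u (n + 1)\<close> does so in any case\<close>
      case True
      have "u (Suc j) = u j * (y - z - 2)" by (simp add: u_def pochhammer_Suc y_def)
      with True u0 show ?thesis by (auto simp: G_def)
    next
      case False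
      then have "j < n" using that by simp
      from nzp[OF this] nzq[OF this] of_nat_neq_0[of j, where 'a = 'a]
      have "w (Suc j) * (y + 1) * (p + y) * (q + y) = w j * (a + y)"
        by (simp add: w_def pochhammer_Suc y_def divide_simps)
      moreover have "u (Suc j) = u j * (y - z - 2)" "v (Suc j) = v j * (z + 1 + y)"
        by (simp_all add: u_def v_def pochhammer_Suc y_def)
      moreover have "G (Suc j) = \<kappa> * u (Suc j) * v (Suc j) * (w (Suc j) * (y + 1) * (p + y) * (q + y))"
        by (simp add: G_def y_def algebra_simps)
      ultimately show ?thesis by (simp add: mult_ac)
    qed
    \<comment> \<open>This is the telescoping equation divided by the common factor; here the
      relation \<open>p + q = 1 + 2 * a\<close> enters.\<close>
    have key: "(p+z+1)*(q+z+1)*((z+1+y)*(z+2+y)) - (z+2-p)*(z+2-q)*((y-z-2)*(y-z-1))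
       = -2*(2*z+3)*((y-z-2)*(z+1+y)*(a+y) - y*(p+y-1)*(q+y-1))"
      using pq by algebra
    have "(p + z + 1) * (q + z + 1) * F (k + 2) j - (z + 2 - p) * (z + 2 - q) * F k j
      = u j * v j * w j / ((z + 1) * (z + 2)) * ((p+z+1)*(q+z+1)*((z+1+y)*(z+2+y)) - (z+2-p)*(z+2-q)*((y-z-2)*(y-z-1)))"
      unfolding F1 F2 using z by (simp add: divide_simps) algebra
    also have "\<dots> = G (Suc j) - G j"
      unfolding key G1 unfolding G_def y_def[symmetric] \<kappa>_def using z by (simp add: divide_simps) algebra
    finally show ?thesis .
  qed
  have "(\<Sum>j\<le>n. (p + z + 1) * (q + z + 1) * F (k + 2) j - (z + 2 - p) * (z + 2 - q) * F k j)
      = (\<Sum>j<Suc n. G (Suc j) - G j)"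
    unfolding lessThan_Suc_atMost by (intro sum.cong refl tele) auto
  also have "\<dots> = 0"
    by (subst sum_lessThan_telescope) (simp add: G_def u0)
  finally show ?thesis
    unfolding W z_def by (simp add: sum_subtractf sum_distrib_left[symmetric])
qed

section \<open>Interchange of the double sum\<close>

text \<open>This is the inner sum after the interchange. Its terms with \<open>k < j\<close> vanish,
  and the substitution \<open>k = i + j\<close> turns the rest into the 4F3 of length
  \<open>n - j\<close>.\<close>

lemma very_well_poised_4F3_sum_from:
  fixes a :: "'a :: field_char_0"
  assumes "j \<le> n"
  shows "(\<Sum>k\<le>n. (2 * of_nat k + 1) * pochhammer (a + of_nat n) k * pochhammer (2 - a - of_nat n + of_nat k) (n - k)
           / (fact (n - k) * fact (n + k + 1)) * (pochhammer (- of_nat k) j * pochhammer (of_nat k + 1) j))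
         = (-1) ^ j * pochhammer (a + of_nat n) j / fact (n - j)" (is "sum ?f _ = ?rhs")
proof -
  define N where "N = n - j"
  have n: "n = N + j" using assms by (simp add: N_def)
  \<comment> \<open>The values come from \<open>2 * k + 1 = m + 2 * i\<close> at
    \<open>k = i + j\<close>, and from splitting \<open>pochhammer (a + of_nat n) (i + j)\<close>
    after its first \<open>j\<close> factors, which leaves \<open>pochhammer c i\<close>.\<close>
  define m :: 'a where "m = of_nat (2 * j) + 1"
  define c where "c = a + of_nat n + of_nat j"
  define T where "T i = of_nat (N choose i) * (m + 2 * of_nat i) * pochhammer c i
            * pochhammer (m + of_nat i + 1 - c) (N - i) / pochhammer (m + of_nat i) (Suc N)" for i
  have summand: "?f (i + j) = ?rhs * T i" if "i \<le> N" for i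
  proof -
    have 1: "pochhammer (- of_nat (i + j)) j = (-1) ^ j * (fact (i + j) / fact i :: 'a)"
      unfolding pochhammer_minus by (simp flip: pochhammer_of_nat_plus_1)
    have 2: "pochhammer (of_nat (i + j) + 1) j = (fact (i + 2 * j) / fact (i + j) :: 'a)"
      by (simp only: pochhammer_of_nat_plus_1) (simp add: mult_2 add.assoc)
    have "m + of_nat i = of_nat (i + 2 * j) + 1" by (simp add: m_def)
    then have "pochhammer (m + of_nat i) (Suc N) = fact (i + 2 * j + Suc N) / fact (i + 2 * j)"
      by (simp only: pochhammer_of_nat_plus_1)
    also have "i + 2 * j + Suc N = n + (i + j) + 1" by (simp add: n)
    finally have 3: "pochhammer (m + of_nat i) (Suc N) = fact (n + (i + j) + 1) / fact (i + 2 * j)" .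
    have 4: "of_nat (N choose i) = (fact N / (fact i * fact (N - i)) :: 'a)"
      using that by (rule binomial_fact)
    have 5: "pochhammer (a + of_nat n) (i + j) = pochhammer (a + of_nat n) j * pochhammer c i"
      unfolding c_def by (subst add.commute) (simp only: pochhammer_product')
    have 6: "2 - a - of_nat n + of_nat (i + j) = m + of_nat i + 1 - c" "n - (i + j) = N - i"
      by (simp_all add: m_def c_def n)
    have 7: "2 * of_nat (i + j) + 1 = m + 2 * of_nat i"
      by (simp add: m_def)
    show ?thesis
      unfolding T_def 1 2 3 4 5 6 7 N_def[symmetric] by (simp add: divide_simps)
  qed
  have "sum ?f {..n} = sum ?f {0 + j..N + j}"
    unfolding n by (rule sum.mono_neutral_right) (auto simp: pochhammer_of_nat_eq_0_iff)
  also have "\<dots> = (\<Sum>i=0..N. ?f (i + j))"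
    by (rule sum.shift_bounds_cl_nat_ivl)
  also have "\<dots> = (\<Sum>i\<le>N. ?rhs * T i)"
    unfolding atMost_atLeast0 by (intro sum.cong refl summand) auto
  also have "\<dots> = ?rhs * (\<Sum>i\<le>N. T i)"
    by (simp add: sum_distrib_left)
  also have "(\<Sum>i\<le>N. T i) = 1"
    unfolding T_def
  proof (rule very_well_poised_4F3_summation)
    show "m + of_nat i \<noteq> 0" for i
      using of_nat_neq_0[of "2 * j + i", where 'a = 'a] by (simp add: m_def add_ac)
  qed
  finally show ?thesis by simp
qed

lemma very_well_poised_3F2_double_sum:
  fixes a p q :: "'a :: field_char_0"
  assumes pq: "p + q = 1 + 2 * a"
    and nz: "\<And>j. j < n \<Longrightarrow> p + of_nat j \<noteq> 0" "\<And>j. j < n \<Longrightarrow> q + of_nat j \<noteq> 0"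
  shows "(\<Sum>k\<le>n. (2 * of_nat k + 1) * pochhammer (a + of_nat n) k * pochhammer (2 - a - of_nat n + of_nat k) (n - k)
           / (fact (n - k) * fact (n + k + 1))
           * (\<Sum>j\<le>n. pochhammer (- of_nat k) j * pochhammer (of_nat k + 1) j * pochhammer a j
                        / (pochhammer p j * pochhammer q j * fact j)))
         = pochhammer (p - a) n * pochhammer (q - a) n / (fact n * (pochhammer p n * pochhammer q n))"
    (is "(\<Sum>k\<le>n. ?c k * (\<Sum>j\<le>n. ?w k j)) = ?rhs")
proof -
  define w where "w j = pochhammer a j / (pochhammer p j * pochhammer q j * fact j)" for j
  have "(\<Sum>k\<le>n. ?c k * (\<Sum>j\<le>n. ?w k j))
      = (\<Sum>k\<le>n. \<Sum>j\<le>n. w j * (?c k * (pochhammer (- of_nat k) j * pochhammer (of_nat k + 1) j)))"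
    unfolding sum_distrib_left by (intro sum.cong refl) (simp add: w_def mult_ac)
  also have "\<dots> = (\<Sum>j\<le>n. w j * (\<Sum>k\<le>n. ?c k * (pochhammer (- of_nat k) j * pochhammer (of_nat k + 1) j)))"
    by (subst sum.swap) (simp add: sum_distrib_left)
  also have "\<dots> = (\<Sum>j\<le>n. w j * ((-1) ^ j * pochhammer (a + of_nat n) j / fact (n - j)))"
    by (intro sum.cong refl arg_cong2[where f = "(*)"] very_well_poised_4F3_sum_from) auto
  also have "\<dots> = (\<Sum>j\<le>n. (-1) ^ j * of_nat (n choose j) * pochhammer a j * pochhammer (a + of_nat n) j
            / (pochhammer p j * pochhammer q j) / fact n)"
    by (intro sum.cong refl) (simp add: w_def binomial_fact field_simps)
  also have "\<dots> = ?rhs"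
    \<comment> \<open>Saalschuetz applies with \<open>u = a\<close>: its balancing condition is then
      \<open>p + q = 1 + 2 * a\<close>, the same relation as in Whipple's series.\<close>
    unfolding sum_divide_distrib[symmetric]
    by (subst saalschuetz_summation) (use pq nz in \<open>auto simp: mult_ac\<close>)
  finally show ?thesis .
qed

section \<open>Gamma quotients as Whipple series\<close>

text \<open>Raising \<open>k\<close> by 2 shifts the two halved arguments by one unit each and the
  full argument by two, so the functional equation applies to all three factors.\<close>

lemma Gamma_ratio_recurrence:
  fixes X :: complex
  defines "h \<equiv> \<lambda>k. Gamma (X + of_nat k) * Gamma (X / 2 - of_nat k / 2) * rGamma (X / 2 + of_nat k / 2)"
  assumes "X + of_nat k \<notin> \<int>\<^sub>\<le>\<^sub>0" "X + of_nat k + 1 \<notin> \<int>\<^sub>\<le>\<^sub>0" "X / 2 - of_nat (k + 2) / 2 \<notin> \<int>\<^sub>\<le>\<^sub>0"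
  shows "(X - of_nat k - 2) * h (k + 2) = 4 * (X + of_nat k + 1) * h k"
proof -
  define z where "z = X + of_nat k"
  define y where "y = X / 2 - of_nat (k + 2) / 2"
  have "Gamma (z + 1 + 1) = (z + 1) * (z * Gamma z)"
    unfolding z_def Gamma_plus1[OF assms(3)] Gamma_plus1[OF assms(2)] ..
  then have 1: "Gamma (X + of_nat (k + 2)) = (z + 1) * z * Gamma z"
    by (simp add: z_def add_ac)
  have "Gamma (y + 1) = y * Gamma y"
    using assms(4) by (simp add: Gamma_plus1 y_def)
  also have "y + 1 = X / 2 - of_nat k / 2"
    by (simp add: y_def field_simps)
  finally have 2: "Gamma (X / 2 - of_nat k / 2) = y * Gamma y" .
  have "z / 2 * rGamma (z / 2 + 1) = rGamma (z / 2)"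
    by (rule rGamma_plus1)
  then have 3: "rGamma (X / 2 + of_nat k / 2) = z / 2 * rGamma (X / 2 + of_nat (k + 2) / 2)"
    by (simp add: z_def field_simps)
  have 4: "X - of_nat k - 2 = 2 * y" "X + of_nat k + 1 = z + 1"
    by (simp_all add: y_def z_def field_simps)
  show ?thesis
    unfolding h_def 1 2 3 4 y_def[symmetric] z_def[symmetric] by (simp add: algebra_simps)
qed

text \<open>With p = 1 - X and q = 1 - Y both sides obey the same two-step recurrence, so agreement
  at \<open>k = 0\<close> and \<open>k = 1\<close> suffices.\<close>

lemma Gamma_ratio_product_eq_3F2:
  fixes X Y a :: complex
  defines "h \<equiv> \<lambda>X k. Gamma (X + of_nat k) * Gamma (X / 2 - of_nat k / 2) * rGamma (X / 2 + of_nat k / 2)"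
  assumes "\<And>k. k \<le> n \<Longrightarrow> X + of_nat k \<notin> \<int>\<^sub>\<le>\<^sub>0" "\<And>k. k \<le> n \<Longrightarrow> Y + of_nat k \<notin> \<int>\<^sub>\<le>\<^sub>0"
    and "\<And>k. k \<le> n \<Longrightarrow> X / 2 - of_nat k / 2 \<notin> \<int>\<^sub>\<le>\<^sub>0" "\<And>k. k \<le> n \<Longrightarrow> Y / 2 - of_nat k / 2 \<notin> \<int>\<^sub>\<le>\<^sub>0"
    and nz: "\<And>j. j < n \<Longrightarrow> 1 - X + of_nat j \<noteq> 0" "\<And>j. j < n \<Longrightarrow> 1 - Y + of_nat j \<noteq> 0"
    and XY: "(1 - X) + (1 - Y) = 1 + 2 * a" and "k \<le> n"
  shows "h X k * h Y k = 4 ^ k * (Gamma X * Gamma Y)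
      * (\<Sum>j\<le>n. pochhammer (- of_nat k) j * pochhammer (of_nat k + 1) j * pochhammer a j
                        / (pochhammer (1 - X) j * pochhammer (1 - Y) j * fact j))"
proof -
  define f where "f k j = pochhammer (- of_nat k) j * pochhammer (of_nat k + 1) j * pochhammer a j
                        / (pochhammer (1 - X) j * pochhammer (1 - Y) j * fact j)" for k j
  define W where "W k = (\<Sum>j\<le>n. f k j)" for k
  have W: "W k = (\<Sum>j\<le>k. f k j)" if "k \<le> n" for k
    unfolding W_def using that
    by (intro sum.mono_neutral_right) (auto simp: f_def pochhammer_of_nat_eq_0_iff)
  have h0: "h Z 0 = Gamma Z" if "Z / 2 - of_nat 0 / 2 \<notin> \<int>\<^sub>\<le>\<^sub>0" for Z
    using that by (simp add: h_def rGamma_inverse_Gamma Gamma_eq_zero_iff)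
  \<comment> \<open>The halved arguments are \<open>y\<close> and \<open>y + 1\<close>, so their
    Gamma quotient is 1/y = 2/(Z - 1).\<close>
  have h1: "h Z 1 * (Z - 1) = 2 * Z * Gamma Z"
    if "Z + of_nat 0 \<notin> \<int>\<^sub>\<le>\<^sub>0" "Z / 2 - of_nat 1 / 2 \<notin> \<int>\<^sub>\<le>\<^sub>0" for Z
  proof -
    define y where "y = Z / 2 - 1 / 2"
    have y: "y \<notin> \<int>\<^sub>\<le>\<^sub>0" and Z: "Z = 2 * y + 1" using that by (simp_all add: y_def)
    have "Gamma (Z + 1) = Z * Gamma Z" using that by (simp add: Gamma_plus1)
    moreover have "Gamma y * (y * rGamma (y + 1)) = 1"
      using y unfolding rGamma_plus1 by (simp add: rGamma_inverse_Gamma Gamma_eq_zero_iff)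
    moreover have "h Z 1 = Gamma (Z + 1) * Gamma y * rGamma (y + 1)"
      by (simp add: h_def y_def field_simps)
    moreover have "Z - 1 = 2 * y" by (simp add: Z)
    ultimately show ?thesis by algebra
  qed
  have "h X k * h Y k = 4 ^ k * (Gamma X * Gamma Y) * W k"
    using \<open>k \<le> n\<close>
  proof (induction k rule: induct_nat_012)
    case 0
    have "h X 0 = Gamma X" "h Y 0 = Gamma Y"
      using assms(4,5)[of 0] by (auto intro!: h0)
    moreover have "W 0 = 1"
      by (subst W) (simp_all add: f_def)
    ultimately show ?case by simp
  next
    case 1
    have X1: "1 - X \<noteq> 0" "1 - Y \<noteq> 0" using nz[of 0] 1 by auto
    have W1: "W 1 = 1 - 2 * a / ((1 - X) * (1 - Y))"
      using 1 by (subst W) (simp_all add: f_def)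
    have "h X 1 * (X - 1) = 2 * X * Gamma X"
      by (rule h1) (use assms(2)[of 0] assms(4)[of 1] 1 in auto)
    moreover have "h Y 1 * (Y - 1) = 2 * Y * Gamma Y"
      by (rule h1) (use assms(3)[of 0] assms(5)[of 1] 1 in auto)
    ultimately have "h X 1 * h Y 1 * ((1 - X) * (1 - Y)) = 4 * (X * Y) * (Gamma X * Gamma Y)"
      by algebra
    \<comment> \<open>The hypothesis gives \<open>2 * a = 1 - X - Y\<close>, hence
      \<open>(1 - X) * (1 - Y) - 2 * a = X * Y\<close>.\<close>
    also have "X * Y = W 1 * ((1 - X) * (1 - Y))"
      using X1 XY unfolding W1 by (simp add: divide_simps) algebra
    finally show ?case using X1 by simp
  next
    case (ge2 k)
    have k: "k + 2 \<le> n" using ge2.prems by simp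
    have hX: "(X - of_nat k - 2) * h X (k + 2) = 4 * (X + of_nat k + 1) * h X k"
      unfolding h_def using assms(2)[of k] assms(2)[of "Suc k"] assms(4)[of "k + 2"] k
      by (intro Gamma_ratio_recurrence) (simp_all add: add_ac)
    have hY: "(Y - of_nat k - 2) * h Y (k + 2) = 4 * (Y + of_nat k + 1) * h Y k"
      unfolding h_def using assms(3)[of k] assms(3)[of "Suc k"] assms(5)[of "k + 2"] k
      by (intro Gamma_ratio_recurrence) (simp_all add: add_ac)
    have Wrec: "(1 - X + of_nat k + 1) * (1 - Y + of_nat k + 1) * W (k + 2)
        = (of_nat k + 2 - (1 - X)) * (of_nat k + 2 - (1 - Y)) * W k"
      unfolding W_def f_def by (rule whipple_3F2_recurrence) (use XY k nz in auto)
    have "1 - X + of_nat (Suc k) \<noteq> 0" "1 - Y + of_nat (Suc k) \<noteq> 0"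
      using nz[of "Suc k"] k by auto
    then have nz': "1 - X + of_nat k + 1 \<noteq> 0" "1 - Y + of_nat k + 1 \<noteq> 0"
      by (simp_all add: add_ac)
    have IH: "h X k * h Y k = 4 ^ k * (Gamma X * Gamma Y) * W k"
      using ge2 by simp
    \<comment> \<open>Here \<open>1 - X + k + 1 = - (X - k - 2)\<close>, likewise for
      \<open>Y\<close>, and the two signs cancel in the product.\<close>
    have "(1 - X + of_nat k + 1) * (1 - Y + of_nat k + 1) * (h X (k + 2) * h Y (k + 2))
       = ((X - of_nat k - 2) * h X (k + 2)) * ((Y - of_nat k - 2) * h Y (k + 2))"
      by (simp add: algebra_simps)
    also have "\<dots> = 16 * (X + of_nat k + 1) * (Y + of_nat k + 1) * (h X k * h Y k)"
      unfolding hX hY by algebra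
    also have "\<dots> = 4 ^ (k + 2) * (Gamma X * Gamma Y) * ((of_nat k + 2 - (1 - X)) * (of_nat k + 2 - (1 - Y)) * W k)"
      unfolding IH by (simp add: algebra_simps)
    also have "\<dots> = (1 - X + of_nat k + 1) * (1 - Y + of_nat k + 1) * (4 ^ (k + 2) * (Gamma X * Gamma Y) * W (k + 2))"
      unfolding Wrec[symmetric] by (simp add: mult_ac)
    finally show ?case using nz' by simp
  qed
  then show ?thesis unfolding W_def f_def .
qed

section \<open>Evaluation of the Fox-Wright sum\<close>

theorem theorem10:
  fixes a b :: complex and n :: nat
  assumes "\<And>k. k \<le> n \<Longrightarrow> 1 - a - b + of_nat k \<notin> \<int>\<^sub>\<le>\<^sub>0"
    and "\<And>k. k \<le> n \<Longrightarrow> b - a + of_nat k \<notin> \<int>\<^sub>\<le>\<^sub>0"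
    and "\<And>k. k \<le> n \<Longrightarrow> a + of_nat n + of_nat k \<notin> \<int>\<^sub>\<le>\<^sub>0"
    and "\<And>k. k \<le> n \<Longrightarrow> (1 - a - b) / 2 - of_nat k / 2 \<notin> \<int>\<^sub>\<le>\<^sub>0"
    and "\<And>k. k \<le> n \<Longrightarrow> (b - a) / 2 - of_nat k / 2 \<notin> \<int>\<^sub>\<le>\<^sub>0"
    and "pochhammer (a + b) n * pochhammer (1 + a - b) n \<noteq> 0"
  shows
    "(\<Sum>k=0..n.
        (Gamma (1 + of_nat k) * Gamma (3/2 + of_nat k) * Gamma (1 - a - b + of_nat k)
          * Gamma (b - a + of_nat k) * Gamma (a + of_nat n + of_nat k)
          * Gamma ((1 - a - b) / 2 - of_nat k / 2) * Gamma ((b - a) / 2 - of_nat k / 2))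
        * (rGamma (1 + of_nat n - of_nat k) * rGamma (2 + of_nat n + of_nat k)
          * rGamma (2 - a - of_nat n + of_nat k) * rGamma (1/2 + of_nat k)
          * rGamma ((1 - a - b) / 2 + of_nat k / 2) * rGamma ((b - a) / 2 + of_nat k / 2))
        * (1 / (4 ^ k * fact k)))
     = (pochhammer b n * pochhammer (1 - b) n)
         / (pochhammer (a + b) n * pochhammer (1 + a - b) n)
       * (Gamma (a + of_nat n) * Gamma (1 - a - b) * Gamma (b - a)
          * rGamma (1 + of_nat n) * rGamma (2 - a) / 2)"
proof -
  define X where "X = 1 - a - b"
  define Y where "Y = b - a"
  have nzp: "a + b + of_nat j \<noteq> 0" and nzq: "1 + a - b + of_nat j \<noteq> 0" if "j < n" for j
    using assms(6) that by (auto simp: pochhammer_neq_0_iff)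
  have pq: "1 - X = a + b" "1 - Y = 1 + a - b"
    by (simp_all add: X_def Y_def)
  define h where "h X k = Gamma (X + of_nat k) * Gamma (X / 2 - of_nat k / 2) * rGamma (X / 2 + of_nat k / 2)"
    for X :: complex and k :: nat
  define W where "W k = (\<Sum>j\<le>n. pochhammer (- of_nat k) j * pochhammer (of_nat k + 1) j * pochhammer a j
                        / (pochhammer (a + b) j * pochhammer (1 + a - b) j * fact j))" for k
  define c where "c k = (2 * of_nat k + 1) * pochhammer (a + of_nat n) k * pochhammer (2 - a - of_nat n + of_nat k) (n - k)
           / (fact (n - k) * fact (n + k + 1))" for k
  \<comment> \<open>\<open>K\<close> collects what does not depend on \<open>k\<close>; its factor
    1/2 comes from Gamma(3/2 + k)/Gamma(1/2 + k) = (2k + 1)/2, which also supplies the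
    very-well-poised factor of \<open>c k\<close>.\<close>
  define K where "K = Gamma (a + of_nat n) * Gamma X * Gamma Y * rGamma (2 - a) / 2"
  have h: "h X k * h Y k = 4 ^ k * (Gamma X * Gamma Y) * W k" if "k \<le> n" for k
    unfolding h_def W_def pq[symmetric]
    by (rule Gamma_ratio_product_eq_3F2) (use assms(1-5)[folded X_def Y_def] nzp nzq that in \<open>auto simp: pq\<close>)
  have summand: "(Gamma (1 + of_nat k) * Gamma (3/2 + of_nat k) * Gamma (X + of_nat k)
          * Gamma (Y + of_nat k) * Gamma (a + of_nat n + of_nat k)
          * Gamma (X / 2 - of_nat k / 2) * Gamma (Y / 2 - of_nat k / 2))
        * (rGamma (1 + of_nat n - of_nat k) * rGamma (2 + of_nat n + of_nat k)
          * rGamma (2 - a - of_nat n + of_nat k) * rGamma (1/2 + of_nat k)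
          * rGamma (X / 2 + of_nat k / 2) * rGamma (Y / 2 + of_nat k / 2))
        * (1 / (4 ^ k * fact k)) = K * (c k * W k)" (is "?L = _") if "k \<le> n" for k
  proof -
    have 1: "Gamma (1 + of_nat k) = (fact k :: complex)"
      by (rule Gamma_fact)
    have half: "(1/2 + of_nat k :: complex) \<notin> \<int>\<^sub>\<le>\<^sub>0"
      by (auto elim!: nonpos_Ints_cases simp: complex_eq_iff)
    have "Gamma (1/2 + of_nat k + 1) = (1/2 + of_nat k) * Gamma (1/2 + of_nat k :: complex)"
      using half by (rule Gamma_plus1)
    then have 2: "Gamma (3/2 + of_nat k) * rGamma (1/2 + of_nat k) = ((2 * of_nat k + 1) / 2 :: complex)"
      using half by (simp add: add_divide_distrib add_ac rGamma_inverse_Gamma Gamma_eq_zero_iff)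
    have 3: "Gamma (a + of_nat n + of_nat k) = pochhammer (a + of_nat n) k * Gamma (a + of_nat n)"
      using assms(3)[of 0] by (simp add: pochhammer_Gamma Gamma_eq_zero_iff)
    have "rGamma (1 + of_nat n - of_nat k) = rGamma (1 + of_nat (n - k) :: complex)"
      using that by (simp add: of_nat_diff algebra_simps)
    then have 4: "rGamma (1 + of_nat n - of_nat k) = (1 / fact (n - k) :: complex)"
      by (simp only: rGamma_inverse_Gamma Gamma_fact inverse_eq_divide)
    have "rGamma (2 + of_nat n + of_nat k) = rGamma (1 + of_nat (n + k + 1) :: complex)"
      by (simp add: algebra_simps)
    then have 5: "rGamma (2 + of_nat n + of_nat k) = (1 / fact (n + k + 1) :: complex)"
      by (simp only: rGamma_inverse_Gamma Gamma_fact inverse_eq_divide)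
    \<comment> \<open>The shift rule for \<open>rGamma\<close> holds without exceptions, so 2 - a -
      n + k may be a pole of Gamma.\<close>
    have 6: "rGamma (2 - a - of_nat n + of_nat k)
        = pochhammer (2 - a - of_nat n + of_nat k) (n - k) * rGamma (2 - a)"
      using pochhammer_rGamma[of "2 - a - of_nat n + of_nat k" "n - k"] that by (simp add: of_nat_diff)
    \<comment> \<open>\<open>Gamma (1 + of_nat k)\<close> cancels \<open>fact k\<close>; the
      remaining 4^k will cancel against the one in \<open>h\<close>.\<close>
    have "?L = (Gamma (3/2 + of_nat k) * rGamma (1/2 + of_nat k)) * (h X k * h Y k)
        * (Gamma (a + of_nat n + of_nat k) * rGamma (1 + of_nat n - of_nat k) * rGamma (2 + of_nat n + of_nat k)
          * rGamma (2 - a - of_nat n + of_nat k)) / 4 ^ k"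
      unfolding 1 by (simp add: h_def)
    also have "\<dots> = K * (c k * W k)"
      unfolding 2 h[OF that] 3 4 5 6 by (simp add: K_def c_def mult_ac)
    finally show ?thesis .
  qed
  have rG: "rGamma (1 + of_nat n) = (1 / fact n :: complex)"
    by (simp only: rGamma_inverse_Gamma Gamma_fact inverse_eq_divide)
  have "(\<Sum>k=0..n. K * (c k * W k)) = K * (\<Sum>k\<le>n. c k * W k)"
    by (simp add: sum_distrib_left atMost_atLeast0)
  also have "(\<Sum>k\<le>n. c k * W k) = pochhammer b n * pochhammer (1 - b) n
      / (fact n * (pochhammer (a + b) n * pochhammer (1 + a - b) n))"
    \<comment> \<open>With \<open>p = a + b\<close> and \<open>q = 1 + a - b\<close>, the parameters
      \<open>p - a\<close> and \<open>q - a\<close> become \<open>b\<close> and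
      \<open>1 - b\<close>.\<close>
    unfolding c_def W_def by (subst very_well_poised_3F2_double_sum) (use nzp nzq in \<open>auto simp: algebra_simps\<close>)
  also have "K * \<dots> = (pochhammer b n * pochhammer (1 - b) n)
         / (pochhammer (a + b) n * pochhammer (1 + a - b) n)
       * (Gamma (a + of_nat n) * Gamma X * Gamma Y
          * rGamma (1 + of_nat n) * rGamma (2 - a) / 2)"
    unfolding K_def rG by (simp add: mult_ac)
  finally have closed_form: "(\<Sum>k=0..n. K * (c k * W k)) = \<dots>" .
  show ?thesis
    unfolding X_def[symmetric] Y_def[symmetric]
    by (rule trans[OF sum.cong[OF refl summand] closed_form]) simp
qed

end
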